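(* Let $m\ge 0$ be an integer, let $K,L,K',L'$ be edge-path connected simplicial complexes, and let $\phi,\psi:K\to L$ and $\phi',\psi':K'\to L'$ be simplicial maps. Then $$\mathrm{SD}_m(\phi\times\phi',\psi\times\psi')+1\le (\mathrm{SD}_m(\phi,\psi)+1)\,(\mathrm{SD}_m(\phi',\psi')+1),$$ where $\phi\times\phi',\psi\times\psi':K\times K'\to L\times L'$ are the product maps between categorical products.
   Context: Simplicial complexes are abstract simplicial complexes. Simplicial maps $f,g:A\to B$ are contiguous, $f\sim_c g$, if for every simplex $\{v_0,\dots,v_k\}$ of $A$ the set $\{f(v_0),\dots,f(v_k),g(v_0),\dots,g(v_k)\}$ is a simplex of $B$. They are in the same contiguity class, $f\sim g$, if there is a finite sequence of simplicial maps $f=f_0\sim_c f_1\sim_c\dots\sim_c f_n=g$ from $A$ to $B$. For an integer $m\ge 0$ and simplicial maps $\varphi,\psi:A\to B$, the $m$-contiguity distance $\mathrm{SD}_m(\varphi,\psi)$ is the least integer $k\ge 0$ such that $A$ is covered by subcomplexes $A_0,\dots,A_k$ with the property that for each $j$ and every simplicial map $\eta:P\to A_j$ from an $m$-dimensional simplicial complex $P$, $\varphi\circ\eta\sim\psi\circ\eta$ ($\infty$ if no such cover exists). The categorical product $K\times L$ has as vertices the pairs $(v,w)$ with $v$ a vertex of $K$ and $w$ a vertex of $L$; a finite set $\{(v_0,w_0),\dots,(v_s,w_s)\}$ is a simplex iff $\{v_0,\dots,v_s\}$ is a simplex of $K$ and $\{w_0,\dots,w_s\}$ is a simplex of $L$.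 The product of simplicial maps is defined on vertices by $(f\times g)(v,w)=(f(v),g(w))$. *)

theory Defs
  imports Main "HOL-Library.Extended_Nat"
begin

text \<open>A complex is given by its set of simplices, which are finite and non-empty; its vertex set is
  the union \<open>\<Union>K\<close>. The empty complex is admitted.\<close>

definition simplicial_complex :: "'a set set \<Rightarrow> bool" where
  "simplicial_complex K \<longleftrightarrow>
     (\<forall>\<sigma>\<in>K. finite \<sigma> \<and> \<sigma> \<noteq> {}) \<and> (\<forall>\<sigma>\<in>K. \<forall>\<tau>. \<tau> \<subseteq> \<sigma> \<and> \<tau> \<noteq> {} \<longrightarrow> \<tau> \<in> K)"

definition subcomplex :: "'a set set \<Rightarrow> 'a set set \<Rightarrow> bool" where
  "subcomplex A K \<longleftrightarrow> simplicial_complex A \<and> A \<subseteq> K"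

definition has_dimension :: "'a set set \<Rightarrow> nat \<Rightarrow> bool" where
  "has_dimension K m \<longleftrightarrow> (\<forall>\<sigma>\<in>K. card \<sigma> \<le> m + 1) \<and> (\<exists>\<sigma>\<in>K. card \<sigma> = m + 1)"

definition edge_path_connected :: "'a set set \<Rightarrow> bool" where
  "edge_path_connected K \<longleftrightarrow> (\<forall>v\<in>\<Union>K. \<forall>w\<in>\<Union>K. (\<lambda>x y. {x, y} \<in> K)\<^sup>*\<^sup>* v w)"

text \<open>Maps are total functions on the ambient type, but only their values on vertices matter: two
  simplicial maps that agree on \<open>\<Union>A\<close> are contiguous.\<close>

definition simplicial_map :: "'a set set \<Rightarrow> 'b set set \<Rightarrow> ('a \<Rightarrow> 'b) \<Rightarrow> bool" where
  "simplicial_map A B f \<longleftrightarrow> (\<forall>\<sigma>\<in>A. f ` \<sigma> \<in> B)"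

definition contiguous :: "'a set set \<Rightarrow> 'b set set \<Rightarrow> ('a \<Rightarrow> 'b) \<Rightarrow> ('a \<Rightarrow> 'b) \<Rightarrow> bool" where
  "contiguous A B f g \<longleftrightarrow>
     simplicial_map A B f \<and> simplicial_map A B g \<and> (\<forall>\<sigma>\<in>A. f ` \<sigma> \<union> g ` \<sigma> \<in> B)"

definition same_contiguity_class ::
    "'a set set \<Rightarrow> 'b set set \<Rightarrow> ('a \<Rightarrow> 'b) \<Rightarrow> ('a \<Rightarrow> 'b) \<Rightarrow> bool" where
  "same_contiguity_class A B f g \<longleftrightarrow> simplicial_map A B f \<and> (contiguous A B)\<^sup>*\<^sup>* f g"

text \<open>The test complexes \<open>P\<close> below range over all complexes with vertices in the type \<open>'p\<close>.\<close>

definition m_contiguous_on ::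
    "'p itself \<Rightarrow> nat \<Rightarrow> 'a set set \<Rightarrow> 'b set set \<Rightarrow> ('a \<Rightarrow> 'b) \<Rightarrow> ('a \<Rightarrow> 'b) \<Rightarrow> bool" where
  "m_contiguous_on T m A B \<phi> \<psi> \<longleftrightarrow>
     (\<forall>(P :: 'p set set) \<eta>.
        simplicial_complex P \<and> has_dimension P m \<and> simplicial_map P A \<eta> \<longrightarrow>
        same_contiguity_class P B (\<phi> \<circ> \<eta>) (\<psi> \<circ> \<eta>))"

lemma same_contiguity_class_precompose:
  assumes "same_contiguity_class Q B f g" and h: "simplicial_map P Q h"
  shows "same_contiguity_class P B (f \<circ> h) (g \<circ> h)"
proof -
  have contig: "contiguous P B (u \<circ> h) (v \<circ> h)" if "contiguous Q B u v" for u v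
    using that h unfolding contiguous_def simplicial_map_def image_comp [symmetric] by blast
  from assms(1) have f: "simplicial_map Q B f" and "(contiguous Q B)\<^sup>*\<^sup>* f g"
    by (auto simp: same_contiguity_class_def)
  from this(2) have "(contiguous P B)\<^sup>*\<^sup>* (f \<circ> h) (g \<circ> h)"
  proof (induction rule: rtranclp_induct)
    case (step u v)
    have "contiguous P B (u \<circ> h) (v \<circ> h)" using step.hyps(2) by (rule contig)
    with step.IH show ?case by (rule rtranclp.rtrancl_into_rtrancl [of "contiguous P B"])
  qed (rule rtranclp.rtrancl_refl)
  then show ?thesis
    using f h
    unfolding same_contiguity_class_def simplicial_map_def image_comp [symmetric] by blast
qed

lemma simplicial_complexD:
  assumes "simplicial_complex K" and "\<sigma> \<in> K"
  shows "finite \<sigma>" and "\<sigma> \<noteq> {}" and "\<And>\<tau>. \<tau> \<subseteq> \<sigma> \<Longrightarrow> \<tau> \<noteq> {} \<Longrightarrow> \<tau> \<in> K"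
  using assms unfolding simplicial_complex_def by blast+

text \<open>The vertex type \<open>'a + nat\<close> is large enough to test all \<open>P\<close>, over any vertex type: every
  \<open>\<eta>\<close> factors through the disjoint union of the \<open>m\<close>-skeleton of \<open>A\<close> and one \<open>m\<close>-simplex.\<close>

lemma m_contiguous_on_any_type:
  fixes A :: "'a set set"
  assumes A: "simplicial_complex A"
    and univ: "m_contiguous_on TYPE('a + nat) m A B \<phi> \<psi>"
  shows "m_contiguous_on TYPE('p) m A B \<phi> \<psi>"
  unfolding m_contiguous_on_def
proof (intro allI impI, elim conjE)
  fix P :: "'p set set" and \<eta> :: "'p \<Rightarrow> 'a"
  assume P: "simplicial_complex P" "has_dimension P m" and \<eta>: "simplicial_map P A \<eta>"
  obtain \<sigma>0 where "\<sigma>0 \<in> P" using P(2) unfolding has_dimension_def by blast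
  then obtain v where "v \<in> \<sigma>0" using simplicial_complexD(2) [OF P(1)] by blast
  with \<open>\<sigma>0 \<in> P\<close> have "{v} \<in> P" using simplicial_complexD(3) [OF P(1), of \<sigma>0 "{v}"] by simp
  define a where "a = \<eta> v"
  have a: "{a} \<in> A" using \<eta> \<open>{v} \<in> P\<close> unfolding simplicial_map_def a_def by fastforce
  define Q1 :: "('a + nat) set set" where "Q1 = {Inl ` \<sigma> | \<sigma>. \<sigma> \<in> A \<and> card \<sigma> \<le> m + 1}"
  define Q2 :: "('a + nat) set set" where "Q2 = {Inr ` \<tau> | \<tau>. \<tau> \<subseteq> {..m} \<and> \<tau> \<noteq> {}}"
  define Q :: "('a + nat) set set" where "Q = Q1 \<union> Q2"
  define h :: "'a + nat \<Rightarrow> 'a" where "h = case_sum id (\<lambda>_. a)"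
  have Q1: "\<tau> \<in> Q" if "\<sigma> \<in> Q1" "\<tau> \<subseteq> \<sigma>" "\<tau> \<noteq> {}" for \<sigma> \<tau>
  proof -
    from that(1) obtain \<rho> where r: "\<sigma> = Inl ` \<rho>" "\<rho> \<in> A" "card \<rho> \<le> m + 1"
      by (auto simp: Q1_def)
    from that(2) r(1) obtain \<rho>' where r': "\<rho>' \<subseteq> \<rho>" "\<tau> = Inl ` \<rho>'" by (auto simp: subset_image_iff)
    have "finite \<rho>" "\<rho>' \<in> A"
      using simplicial_complexD [OF A r(2)] r' that(3) by simp_all
    moreover have "card \<rho>' \<le> m + 1" using card_mono [OF \<open>finite \<rho>\<close> r'(1)] r(3) by linarith
    ultimately show ?thesis using r'(2) unfolding Q_def Q1_def by blast
  qed
  have Q2: "\<tau> \<in> Q" if \<sigma>: "\<sigma> \<in> Q2" and \<tau>: "\<tau> \<subseteq> \<sigma>" "\<tau> \<noteq> {}" for \<sigma> \<tau>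
  proof -
    from \<sigma> obtain \<rho> where r: "\<sigma> = Inr ` \<rho>" "\<rho> \<subseteq> {..m}" by (auto simp: Q2_def)
    from \<tau> r(1) obtain \<rho>' where "\<rho>' \<subseteq> \<rho>" "\<tau> = Inr ` \<rho>'" by (auto simp: subset_image_iff)
    moreover from this have "\<rho>' \<subseteq> {..m}" "\<rho>' \<noteq> {}" using r(2) \<tau>(2) by auto
    ultimately show ?thesis unfolding Q_def Q2_def by blast
  qed
  have "finite \<sigma> \<and> \<sigma> \<noteq> {}" if "\<sigma> \<in> Q" for \<sigma>
  proof (cases "\<sigma> \<in> Q1")
    case True
    then show ?thesis using A unfolding Q1_def simplicial_complex_def by blast
  next
    case False
    with that obtain \<tau> where "\<sigma> = Inr ` \<tau>" "\<tau> \<subseteq> {..m}" "\<tau> \<noteq> {}" by (auto simp: Q_def Q2_def)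
    then show ?thesis using finite_subset [of \<tau> "{..m}"] by simp
  qed
  moreover have "\<tau> \<in> Q" if "\<sigma> \<in> Q" "\<tau> \<subseteq> \<sigma>" "\<tau> \<noteq> {}" for \<sigma> \<tau>
    using that Q1 [of \<sigma> \<tau>] Q2 [of \<sigma> \<tau>] unfolding Q_def by blast
  ultimately have "simplicial_complex Q"
    unfolding simplicial_complex_def by blast
  moreover have "has_dimension Q m"
  proof -
    have "card \<tau> \<le> m + 1" if "\<tau> \<subseteq> {..m}" for \<tau> using card_mono [OF _ that] by simp
    then have "\<forall>\<sigma>\<in>Q. card \<sigma> \<le> m + 1" by (auto simp: Q_def Q1_def Q2_def card_image)
    moreover have "Inr ` {..m} \<in> Q" unfolding Q_def Q2_def by blast
    moreover have "card (Inr ` {..m} :: ('a + nat) set) = m + 1" by (simp add: card_image)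
    ultimately show ?thesis unfolding has_dimension_def by blast
  qed
  moreover have "simplicial_map Q A h"
  proof -
    have "h ` Inr ` \<tau> = {a}" if "\<tau> \<noteq> {}" for \<tau> using that by (auto simp: h_def image_image)
    moreover have "h ` Inl ` \<sigma> = \<sigma>" for \<sigma> by (simp add: h_def image_image)
    ultimately have "\<forall>\<sigma>\<in>Q1. h ` \<sigma> \<in> A" "\<forall>\<sigma>\<in>Q2. h ` \<sigma> \<in> A"
      using a unfolding Q1_def Q2_def by force+
    then show ?thesis unfolding simplicial_map_def Q_def by blast
  qed
  ultimately have "same_contiguity_class Q B (\<phi> \<circ> h) (\<psi> \<circ> h)"
    using univ by (auto simp: m_contiguous_on_def)
  moreover have "simplicial_map P Q (Inl \<circ> \<eta>)"
    unfolding simplicial_map_def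
  proof
    fix \<sigma> assume s: "\<sigma> \<in> P"
    then have "finite \<sigma>" "card \<sigma> \<le> m + 1" "\<eta> ` \<sigma> \<in> A"
      using simplicial_complexD(1) [OF P(1)] P(2) \<eta>
      unfolding has_dimension_def simplicial_map_def by blast+
    moreover from this have "card (\<eta> ` \<sigma>) \<le> m + 1" using card_image_le le_trans by blast
    ultimately show "(Inl \<circ> \<eta>) ` \<sigma> \<in> Q" 
      unfolding Q_def Q1_def image_comp [symmetric] by blast
  qed
  ultimately have "same_contiguity_class P B (\<phi> \<circ> h \<circ> (Inl \<circ> \<eta>)) (\<psi> \<circ> h \<circ> (Inl \<circ> \<eta>))"
    by (rule same_contiguity_class_precompose)
  moreover have "u \<circ> h \<circ> (Inl \<circ> \<eta>) = u \<circ> \<eta>" for u :: "'a \<Rightarrow> 'b" by (auto simp: h_def)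
  ultimately show "same_contiguity_class P B (\<phi> \<circ> \<eta>) (\<psi> \<circ> \<eta>)" by simp
qed

text \<open>The infimum of the empty set is \<open>\<infinity>\<close> in \<^typ>\<open>enat\<close>.\<close>

definition SD :: "nat \<Rightarrow> 'a set set \<Rightarrow> 'b set set \<Rightarrow> ('a \<Rightarrow> 'b) \<Rightarrow> ('a \<Rightarrow> 'b) \<Rightarrow> enat" where
  "SD m A B \<phi> \<psi> = Inf {enat k | k.
     \<exists>C :: nat \<Rightarrow> 'a set set.
       (\<forall>j\<le>k. subcomplex (C j) A \<and> m_contiguous_on TYPE('a + nat) m (C j) B \<phi> \<psi>) \<and>
       (\<Union>j\<le>k. C j) = A}"

definition categorical_product :: "'a set set \<Rightarrow> 'b set set \<Rightarrow> ('a \<times> 'b) set set" where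
  "categorical_product K L = {\<sigma>. finite \<sigma> \<and> fst ` \<sigma> \<in> K \<and> snd ` \<sigma> \<in> L}"

lemma Union_categorical_product:
  assumes "simplicial_complex K" and "simplicial_complex L"
  shows "\<Union>(categorical_product K L) = \<Union>K \<times> \<Union>L"
proof (intro equalityI subsetI)
  fix p assume "p \<in> \<Union>K \<times> \<Union>L"
  then obtain \<sigma> \<tau> where "\<sigma> \<in> K" "fst p \<in> \<sigma>" "\<tau> \<in> L" "snd p \<in> \<tau>" by auto
  then have "{fst p} \<in> K" "{snd p} \<in> L"
    using simplicial_complexD(3) [OF assms(1), of \<sigma> "{fst p}"]
      simplicial_complexD(3) [OF assms(2), of \<tau> "{snd p}"] by simp_all
  then have "{p} \<in> categorical_product K L" by (simp add: categorical_product_def)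
  then show "p \<in> \<Union>(categorical_product K L)" by blast
next
  fix p assume "p \<in> \<Union>(categorical_product K L)"
  then obtain \<sigma> where s: "p \<in> \<sigma>" "fst ` \<sigma> \<in> K" "snd ` \<sigma> \<in> L"
    by (auto simp: categorical_product_def)
  then have "fst p \<in> \<Union>K" "snd p \<in> \<Union>L" by blast+
  then show "p \<in> \<Union>K \<times> \<Union>L" by (simp add: mem_Times_iff)
qed

end

theory Submission
  imports Defs
begin

text \<open>If \<open>C i\<close> and \<open>C' j\<close> are members of optimal covers for the two factors, then a map \<open>\<eta>\<close> into
  \<open>C i \<times> C' j\<close> has components into \<open>C i\<close> and \<open>C' j\<close>, along which the factor maps lie in the same
  contiguity class. A categorical product tests simplices componentwise, so the two chains of
  contiguities can be run one after the other, one in each coordinate, and the products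
  \<open>C i \<times> C' j\<close> form a cover witnessing the bound.\<close>

lemma simplicial_complex_categorical_product:
  assumes "simplicial_complex K" and "simplicial_complex L"
  shows "simplicial_complex (categorical_product K L)"
  unfolding simplicial_complex_def
proof (intro conjI ballI allI impI)
  fix \<sigma> assume s: "\<sigma> \<in> categorical_product K L"
  then show "finite \<sigma>" by (simp add: categorical_product_def)
  \<comment> \<open>The product does not exclude the empty set explicitly: an empty
    \<open>\<sigma>\<close> would project to an empty simplex of \<open>K\<close>.\<close>
  show "\<sigma> \<noteq> {}"
    using s simplicial_complexD(2) [OF assms(1)] by (auto simp: categorical_product_def)
next
  fix \<sigma> \<tau> assume s: "\<sigma> \<in> categorical_product K L" and t: "\<tau> \<subseteq> \<sigma> \<and> \<tau> \<noteq> {}"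
  from t have "fst ` \<tau> \<subseteq> fst ` \<sigma>" "fst ` \<tau> \<noteq> {}" "snd ` \<tau> \<subseteq> snd ` \<sigma>" "snd ` \<tau> \<noteq> {}"
    by auto
  then have "fst ` \<tau> \<in> K" "snd ` \<tau> \<in> L"
    using s simplicial_complexD(3) [OF assms(1), of "fst ` \<sigma>"]
      simplicial_complexD(3) [OF assms(2), of "snd ` \<sigma>"]
    by (simp_all add: categorical_product_def)
  then show "\<tau> \<in> categorical_product K L"
    using s t by (auto simp: categorical_product_def intro: finite_subset)
qed

lemma categorical_product_mono:
  "K \<subseteq> K' \<Longrightarrow> L \<subseteq> L' \<Longrightarrow> categorical_product K L \<subseteq> categorical_product K' L'"
  by (auto simp: categorical_product_def)

lemma subcomplex_categorical_product:
  assumes "subcomplex A K" and "subcomplex A' K'"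
  shows "subcomplex (categorical_product A A') (categorical_product K K')"
  using assms
  by (simp add: subcomplex_def simplicial_complex_categorical_product categorical_product_mono)

lemma simplicial_map_fst: "simplicial_map (categorical_product K L) K fst"
  and simplicial_map_snd: "simplicial_map (categorical_product K L) L snd"
  by (simp_all add: simplicial_map_def categorical_product_def)

lemma simplicial_map_comp:
  assumes "simplicial_map P Q f" and "simplicial_map Q R g"
  shows "simplicial_map P R (g \<circ> f)"
  using assms unfolding simplicial_map_def image_comp [symmetric] by blast

text \<open>Projecting the union of the two image sets to a coordinate gives the union that
  contiguity in that coordinate already places in \<open>L\<close> or \<open>L'\<close>. Finiteness
  comes from the simplices of \<open>P\<close>.\<close>

lemma contiguous_Pair:
  assumes "simplicial_complex P" and "contiguous P L f g" and "contiguous P L' f' g'"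
  shows "contiguous P (categorical_product L L') (\<lambda>x. (f x, f' x)) (\<lambda>x. (g x, g' x))"
  using assms
  by (simp add: contiguous_def simplicial_map_def categorical_product_def image_Un image_image
      simplicial_complexD(1))

lemma contiguous_refl: "simplicial_map A B f \<Longrightarrow> contiguous A B f f"
  by (simp add: contiguous_def simplicial_map_def)

text \<open>Only the start of a chain is simplicial by definition. The end is too: it equals the
  start if the chain is empty, and otherwise it is an endpoint of a contiguity.\<close>

lemma same_contiguity_class_simplicial_map:
  assumes "same_contiguity_class A B f g"
  shows "simplicial_map A B f" and "simplicial_map A B g"
proof -
  show f: "simplicial_map A B f" using assms by (simp add: same_contiguity_class_def)
  have "(contiguous A B)\<^sup>*\<^sup>* f g" using assms by (simp add: same_contiguity_class_def)
  then show "simplicial_map A B g"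
    by (induction rule: rtranclp_induct) (simp_all add: f contiguous_def)
qed

text \<open>The two chains may differ in length, so they are not matched step by step. The first
  coordinate moves while the second rests at \<open>f'\<close>; then the second moves while the
  first rests at \<open>g\<close>. A resting coordinate is simplicial, hence contiguous to
  itself.\<close>

lemma same_contiguity_class_Pair:
  assumes P: "simplicial_complex P"
    and fg: "same_contiguity_class P L f g" and fg': "same_contiguity_class P L' f' g'"
  shows "same_contiguity_class P (categorical_product L L') (\<lambda>x. (f x, f' x)) (\<lambda>x. (g x, g' x))"
proof -
  let ?C = "contiguous P (categorical_product L L')"
  note g = same_contiguity_class_simplicial_map(2) [OF fg]
  note f' = same_contiguity_class_simplicial_map(1) [OF fg']
  have "(contiguous P L)\<^sup>*\<^sup>* f g" using fg by (simp add: same_contiguity_class_def)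
  then have "?C\<^sup>*\<^sup>* (\<lambda>x. (f x, f' x)) (\<lambda>x. (g x, f' x))"
  proof (induction rule: rtranclp_induct)
    case (step u v)
    then show ?case
      using contiguous_Pair [OF P step.hyps(2) contiguous_refl [OF f']]
      by (meson rtranclp.rtrancl_into_rtrancl)
  qed simp
  moreover have "(contiguous P L')\<^sup>*\<^sup>* f' g'" using fg' by (simp add: same_contiguity_class_def)
  then have "?C\<^sup>*\<^sup>* (\<lambda>x. (g x, f' x)) (\<lambda>x. (g x, g' x))"
  proof (induction rule: rtranclp_induct)
    case (step u v)
    then show ?case
      using contiguous_Pair [OF P contiguous_refl [OF g] step.hyps(2)]
      by (meson rtranclp.rtrancl_into_rtrancl)
  qed simp
  ultimately have "?C\<^sup>*\<^sup>* (\<lambda>x. (f x, f' x)) (\<lambda>x. (g x, g' x))" by (rule rtranclp_trans)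
  moreover have "simplicial_map P (categorical_product L L') (\<lambda>x. (f x, f' x))"
    using P f' same_contiguity_class_simplicial_map(1) [OF fg]
    by (simp add: simplicial_map_def categorical_product_def image_image simplicial_complexD(1))
  ultimately show ?thesis by (simp add: same_contiguity_class_def)
qed

text \<open>Both hypotheses are applied to the same complex \<open>P\<close>, so they are stated for
  one common vertex type \<open>'p\<close>.\<close>

lemma m_contiguous_on_map_prod:
  assumes "m_contiguous_on TYPE('p) m A L \<phi> \<psi>" and "m_contiguous_on TYPE('p) m A' L' \<phi>' \<psi>'"
  shows "m_contiguous_on TYPE('p) m (categorical_product A A') (categorical_product L L')
    (map_prod \<phi> \<phi>') (map_prod \<psi> \<psi>')"
  unfolding m_contiguous_on_def
proof (intro allI impI, elim conjE)
  fix P :: "'p set set" and \<eta>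
  assume P: "simplicial_complex P" "has_dimension P m"
    and \<eta>: "simplicial_map P (categorical_product A A') \<eta>"
  have "same_contiguity_class P L (\<phi> \<circ> (fst \<circ> \<eta>)) (\<psi> \<circ> (fst \<circ> \<eta>))"
    using assms(1) P simplicial_map_comp [OF \<eta> simplicial_map_fst]
    unfolding m_contiguous_on_def by blast
  moreover have "same_contiguity_class P L' (\<phi>' \<circ> (snd \<circ> \<eta>)) (\<psi>' \<circ> (snd \<circ> \<eta>))"
    using assms(2) P simplicial_map_comp [OF \<eta> simplicial_map_snd]
    unfolding m_contiguous_on_def by blast
  ultimately show "same_contiguity_class P (categorical_product L L')
      (map_prod \<phi> \<phi>' \<circ> \<eta>) (map_prod \<psi> \<psi>' \<circ> \<eta>)"
    using same_contiguity_class_Pair [OF P(1)] by (simp add: comp_def map_prod_def case_prod_beta)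
qed

lemma SD_le:
  fixes A :: "'a set set"
  assumes "\<And>j. j \<le> k \<Longrightarrow> subcomplex (C j) A"
    and "\<And>j. j \<le> k \<Longrightarrow> m_contiguous_on TYPE('a + nat) m (C j) B \<phi> \<psi>"
    and "(\<Union>j\<le>k. C j) = A"
  shows "SD m A B \<phi> \<psi> \<le> enat k"
  unfolding SD_def by (rule Inf_lower) (use assms in blast)

text \<open>A finite distance is attained, since \<open>enat\<close> is well-ordered and the infimum
  of a non-empty set is its least element.\<close>

lemma SD_cover:
  fixes A :: "'a set set"
  assumes "SD m A B \<phi> \<psi> = enat k"
  obtains C where "\<And>j. j \<le> k \<Longrightarrow> subcomplex (C j) A"
    and "\<And>j. j \<le> k \<Longrightarrow> m_contiguous_on TYPE('a + nat) m (C j) B \<phi> \<psi>"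
    and "(\<Union>j\<le>k. C j) = A"
proof -
  let ?S = "{enat k | k. \<exists>C :: nat \<Rightarrow> 'a set set.
       (\<forall>j\<le>k. subcomplex (C j) A \<and> m_contiguous_on TYPE('a + nat) m (C j) B \<phi> \<psi>) \<and>
       (\<Union>j\<le>k. C j) = A}"
  have Inf: "Inf ?S = enat k" using assms by (simp add: SD_def)
  \<comment> \<open>Without any admissible cover the infimum would be
    \<open>\<infinity>\<close>.\<close>
  then have "?S \<noteq> {}" by (metis Inf_empty top_enat_def enat.distinct(1))
  then have "Inf ?S \<in> ?S" by (simp only: Inf_enat_def if_False) (rule LeastI_ex, blast)
  then have "enat k \<in> ?S" unfolding Inf .
  then obtain C where "\<forall>j\<le>k. subcomplex (C j) A \<and> m_contiguous_on TYPE('a + nat) m (C j) B \<phi> \<psi>"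
    "(\<Union>j\<le>k. C j) = A" by blast
  then show thesis by (intro that [of C]) simp_all
qed

theorem theorem4p1:
  fixes m :: nat
    and K :: "'a set set" and L :: "'b set set"
    and K' :: "'c set set" and L' :: "'d set set"
    and \<phi> \<psi> :: "'a \<Rightarrow> 'b" and \<phi>' \<psi>' :: "'c \<Rightarrow> 'd"
  assumes "simplicial_complex K" and "simplicial_complex L"
    and "simplicial_complex K'" and "simplicial_complex L'"
    and "edge_path_connected K" and "edge_path_connected L"
    and "edge_path_connected K'" and "edge_path_connected L'"
    and "simplicial_map K L \<phi>" and "simplicial_map K L \<psi>"
    and "simplicial_map K' L' \<phi>'" and "simplicial_map K' L' \<psi>'"
  shows "SD m (categorical_product K K') (categorical_product L L')
             (map_prod \<phi> \<phi>') (map_prod \<psi> \<psi>') + 1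
         \<le> (SD m K L \<phi> \<psi> + 1) * (SD m K' L' \<phi>' \<psi>' + 1)"
proof (cases "SD m K L \<phi> \<psi> = \<infinity> \<or> SD m K' L' \<phi>' \<psi>' = \<infinity>")
  case True
  \<comment> \<open>One factor is infinite and the other is at least 1, so the product cannot
    collapse to 0.\<close>
  then have "(SD m K L \<phi> \<psi> + 1) * (SD m K' L' \<phi>' \<psi>' + 1) = \<infinity>"
    by (auto simp: imult_is_infinity)
  then show ?thesis by simp
next
  case False
  then obtain k k' where k: "SD m K L \<phi> \<psi> = enat k" and k': "SD m K' L' \<phi>' \<psi>' = enat k'"
    by auto
  obtain C where C: "\<And>j. j \<le> k \<Longrightarrow> subcomplex (C j) K"
      "\<And>j. j \<le> k \<Longrightarrow> m_contiguous_on TYPE('a + nat) m (C j) L \<phi> \<psi>" "(\<Union>j\<le>k. C j) = K"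
    by (rule SD_cover [OF k]) (rule that; assumption)
  obtain C' where C': "\<And>j. j \<le> k' \<Longrightarrow> subcomplex (C' j) K'"
      "\<And>j. j \<le> k' \<Longrightarrow> m_contiguous_on TYPE('c + nat) m (C' j) L' \<phi>' \<psi>'" "(\<Union>j\<le>k'. C' j) = K'"
    by (rule SD_cover [OF k']) (rule that; assumption)
  \<comment> \<open>The pairs \<open>(i, i')\<close> with \<open>i \<le> k\<close> and
    \<open>i' \<le> k'\<close> are numbered as \<open>i * (k' + 1) + i'\<close>. There are
    \<open>(k + 1) * (k' + 1)\<close> of them, and \<open>n\<close> is the last number.\<close>
  define n where "n = k * (k' + 1) + k'"
  define D where "D j = categorical_product (C (j div (k' + 1))) (C' (j mod (k' + 1)))" for j
  have bounds: "j div (k' + 1) \<le> k" "j mod (k' + 1) \<le> k'" if "j \<le> n" for j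
  proof -
    have "j < (k + 1) * (k' + 1)" using that by (simp add: n_def algebra_simps)
    then have "j div (k' + 1) < k + 1" by (simp add: less_mult_imp_div_less)
    then show "j div (k' + 1) \<le> k" by simp
    show "j mod (k' + 1) \<le> k'" using mod_less_divisor [of "k' + 1" j] by linarith
  qed
  have sub: "subcomplex (D j) (categorical_product K K')" if "j \<le> n" for j
    unfolding D_def by (intro subcomplex_categorical_product C C' bounds that)
  have "SD m (categorical_product K K') (categorical_product L L')
      (map_prod \<phi> \<phi>') (map_prod \<psi> \<psi>') \<le> enat n"
  proof (rule SD_le [of n D, OF sub])
    fix j assume j: "j \<le> n"
    \<comment> \<open>The covers of \<open>K\<close> and \<open>K'\<close> were tested over
      \<open>'a + nat\<close> and \<open>'c + nat\<close>, whereas the product is tested over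
      \<open>'a \<times> 'c + nat\<close>. The change of vertex type needs each cover member to be a
      complex.\<close>
    have "m_contiguous_on TYPE('a \<times> 'c + nat) m (C (j div (k' + 1))) L \<phi> \<psi>"
      using C(1) [OF bounds(1) [OF j]] m_contiguous_on_any_type [OF _ C(2) [OF bounds(1) [OF j]]]
      unfolding subcomplex_def by blast
    moreover have "m_contiguous_on TYPE('a \<times> 'c + nat) m (C' (j mod (k' + 1))) L' \<phi>' \<psi>'"
      using C'(1) [OF bounds(2) [OF j]] m_contiguous_on_any_type [OF _ C'(2) [OF bounds(2) [OF j]]]
      unfolding subcomplex_def by blast
    ultimately show "m_contiguous_on TYPE('a \<times> 'c + nat) m (D j) (categorical_product L L')
        (map_prod \<phi> \<phi>') (map_prod \<psi> \<psi>')"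
      unfolding D_def by (rule m_contiguous_on_map_prod)
  next
    show "(\<Union>j\<le>n. D j) = categorical_product K K'"
    proof
      show "(\<Union>j\<le>n. D j) \<subseteq> categorical_product K K'" using sub by (auto simp: subcomplex_def)
      show "categorical_product K K' \<subseteq> (\<Union>j\<le>n. D j)"
      proof
        fix \<sigma> assume s: "\<sigma> \<in> categorical_product K K'"
        \<comment> \<open>The covers are covers by simplices: each projection of
          \<open>\<sigma>\<close> lies as a whole in a single member.\<close>
        then have "fst ` \<sigma> \<in> (\<Union>j\<le>k. C j)" "snd ` \<sigma> \<in> (\<Union>j\<le>k'. C' j)"
          unfolding C(3) C'(3) by (simp_all add: categorical_product_def)
        then obtain i i' where i: "i \<le> k" "fst ` \<sigma> \<in> C i" and i': "i' \<le> k'" "snd ` \<sigma> \<in> C' i'"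
          by blast
        let ?j = "i * (k' + 1) + i'"
        \<comment> \<open>Decoding succeeds because \<open>i' < k' + 1\<close>.\<close>
        have "?j div (k' + 1) = i" "?j mod (k' + 1) = i'"
          using i'(1) div_mult_self3 [of "k' + 1" i i'] mod_mult_self3 [of i "k' + 1" i']
          by simp_all
        then have "\<sigma> \<in> D ?j"
          using s i(2) i'(2) by (simp only: D_def categorical_product_def mem_Collect_eq simp_thms)
        moreover have "?j \<le> n"
          unfolding n_def by (intro add_mono mult_right_mono i i') simp
        ultimately show "\<sigma> \<in> (\<Union>j\<le>n. D j)" by blast
      qed
    qed
  qed
  then have "SD m (categorical_product K K') (categorical_product L L')
      (map_prod \<phi> \<phi>') (map_prod \<psi> \<psi>') + 1 \<le> enat n + 1"
    by (rule add_right_mono)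
  \<comment> \<open>The number of product pieces is
    \<open>n + 1 = (k + 1) * (k' + 1)\<close>.\<close>
  also have "\<dots> = (enat k + 1) * (enat k' + 1)"
    by (simp add: n_def one_enat_def algebra_simps)
  finally show ?thesis by (simp only: k k')
qed

end
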